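(* Let $\mathbb{G}$ be a homogeneous group, $\Omega\subseteq\mathbb{G}$ open, $T>0$, and let $b=(b_t)_{t\in[0,T]}$ be a time-dependent Lipschitz horizontal vector field on $\Omega$. Let $\bar x\in\Omega$ satisfy $b(t,\bar x)=0$ for every $t\in[0,T]$. Then the solution to the Cauchy problem $$\dot\gamma(t)=b_t(\gamma(t))\ \text{ for }t\in[0,T],\qquad \gamma(0)=\bar x,$$ is unique (that is, it is the constant curve $\gamma\equiv\bar x$).
   Context: A homogeneous group is a graded finite-dimensional real linear space $\mathbb{G}=H^1\oplus\cdots\oplus H^\iota$ equipped with a Lie algebra structure satisfying $[H^i,H^j]\subseteq H^{i+j}$ (with $H^k=\{0\}$ for $k>\iota$), and with the group operation given by the Baker-Campbell-Hausdorff formula; its identity is $0$. Dilations $\delta_r$, $r>0$, are the linear maps with $\delta_r(x)=r^jx$ for $x\in H^j$. Fix a graded basis $(e_1,\dots,e_{\mathrm q})$ (a basis of $H^1$, followed by one of $H^2$, and so on), identifying $\mathbb{G}$ with $\mathbb{R}^{\mathrm q}$; let $\mathrm m=\dim H^1$ and let $X_i$ be the left-invariant vector field with $X_i(0)=e_i$. A homogeneous distance is a (continuous) left-invariant distance $d$ on $\mathbb{G}$ with $d(\delta_rx,\delta_ry)=r\,d(x,y)$; all such distances are bi-Lipschitz equivalent, and one is fixed. A time-dependent Lipschitz horizontal vector field on $\Omega$ is $b_t(x)=b(t,x)=\sum_{i=1}^{\mathrm m}a_i(t,x)X_i(x)$, $(t,x)\in[0,T]\times\Omega$, where each $a_i$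 is continuous on $[0,T]\times\Omega$ and there is a constant $C>0$ with $|a_i(t,x)-a_i(t,y)|\le C\,d(x,y)$ for all $i\in\{1,\dots,\mathrm m\}$, $x,y\in\Omega$, $t\in[0,T]$. A solution on $[0,T]$ is a continuous curve $\gamma:[0,T]\to\Omega$ with $\gamma(t)=\gamma(0)+\int_0^tb(s,\gamma(s))\,ds$ for every $t\in[0,T]$. *)

theory Defs
  imports "HOL-Analysis.Analysis"
begin

section \<open>Homogeneous groups\<close>

text \<open>
  The underlying space is a Euclidean space \<open>'a\<close>; its inner product serves only to provide the
  linear topology, and the grading is not assumed to be orthogonal. The layers are indexed by
  \<open>1, \<dots>, \<iota>\<close>; the value \<open>H 0\<close> is irrelevant.
\<close>

locale homogeneous_group =
  fixes \<iota> :: nat and H :: "nat \<Rightarrow> 'a::euclidean_space set" and br :: "'a \<Rightarrow> 'a \<Rightarrow> 'a"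
  assumes layer_subspace: "j \<in> {1..\<iota>} \<Longrightarrow> subspace (H j)"
    and layer_beyond: "k > \<iota> \<Longrightarrow> H k = {0}"
    and direct_sum: "\<exists>!c. c \<in> (\<Pi>\<^sub>E j\<in>{1..\<iota>}. H j) \<and> x = (\<Sum>j=1..\<iota>. c j)"
    and br_bilinear: "bilinear br"
    and br_alternating: "br x x = 0"
    and br_jacobi: "br x (br y z) + br y (br z x) + br z (br x y) = 0"
    and br_graded: "i \<in> {1..\<iota>} \<Longrightarrow> j \<in> {1..\<iota>} \<Longrightarrow> x \<in> H i \<Longrightarrow> y \<in> H j \<Longrightarrow> br x y \<in> H (i + j)"

definition layer_part ::
  "nat \<Rightarrow> (nat \<Rightarrow> 'a::euclidean_space set) \<Rightarrow> 'a \<Rightarrow> nat \<Rightarrow> 'a" where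
  "layer_part \<iota> H x = (THE c. c \<in> (\<Pi>\<^sub>E j\<in>{1..\<iota>}. H j) \<and> x = (\<Sum>j=1..\<iota>. c j))"

definition dilation ::
  "nat \<Rightarrow> (nat \<Rightarrow> 'a::euclidean_space set) \<Rightarrow> real \<Rightarrow> 'a \<Rightarrow> 'a" where
  "dilation \<iota> H r x = (\<Sum>j=1..\<iota>. r ^ j *\<^sub>R layer_part \<iota> H x j)"


subsection \<open>The Baker-Campbell-Hausdorff product\<close>

fun nested_bracket :: "('a \<Rightarrow> 'a \<Rightarrow> 'a) \<Rightarrow> 'a::zero list \<Rightarrow> 'a" where
  "nested_bracket br [] = 0"
| "nested_bracket br [x] = x"
| "nested_bracket br (x # y # zs) = br x (nested_bracket br (y # zs))"

text \<open>
  Dynkin's form of the formula: the sum over all \<open>n \<ge> 1\<close> and all pairs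
  \<open>(r\<^sub>1, s\<^sub>1), \<dots>, (r\<^sub>n, s\<^sub>n)\<close> with \<open>r\<^sub>i + s\<^sub>i > 0\<close> of
  \<open>(-1)\<^sup>n\<^sup>-\<^sup>1 / n\<close> times \<open>1 / ((\<Sum>i. r\<^sub>i + s\<^sub>i) \<cdot> (\<Prod>i. r\<^sub>i! s\<^sub>i!))\<close> times the right-nested
  bracket of the word \<open>x\<^bsup>r\<^sub>1\<^esup> y\<^bsup>s\<^sub>1\<^esup> \<dots> x\<^bsup>r\<^sub>n\<^esup> y\<^bsup>s\<^sub>n\<^esup>\<close>. Because
  of the grading, nested brackets of more than \<open>\<iota>\<close> elements vanish, so that the series is the
  finite sum of its terms of order at most \<open>\<iota>\<close>.
\<close>

definition bch_index :: "nat \<Rightarrow> (nat \<times> nat) list set" where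
  "bch_index \<iota> = {ps. ps \<noteq> [] \<and> (\<forall>(r, s)\<in>set ps. r + s > 0) \<and> (\<Sum>(r, s)\<leftarrow>ps. r + s) \<le> \<iota>}"

definition bch_coeff :: "(nat \<times> nat) list \<Rightarrow> real" where
  "bch_coeff ps = (- 1) ^ (length ps - 1) / real (length ps)
     / (real (\<Sum>(r, s)\<leftarrow>ps. r + s) * (\<Prod>(r, s)\<leftarrow>ps. fact r * fact s))"

definition bch_word :: "'a \<Rightarrow> 'a \<Rightarrow> (nat \<times> nat) list \<Rightarrow> 'a list" where
  "bch_word x y ps = concat (map (\<lambda>(r, s). replicate r x @ replicate s y) ps)"

definition bch :: "nat \<Rightarrow> ('a \<Rightarrow> 'a \<Rightarrow> 'a) \<Rightarrow> 'a::real_vector \<Rightarrow> 'a \<Rightarrow> 'a" where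
  "bch \<iota> br x y = (\<Sum>ps\<in>bch_index \<iota>. bch_coeff ps *\<^sub>R nested_bracket br (bch_word x y ps))"

lemma finite_bch_index: "finite (bch_index \<iota>)"
proof (rule finite_subset)
  show "bch_index \<iota> \<subseteq> {ps. set ps \<subseteq> {..\<iota>} \<times> {..\<iota>} \<and> length ps \<le> \<iota>}"
  proof
    fix ps assume "ps \<in> bch_index \<iota>"
    then have pos: "\<forall>(r, s)\<in>set ps. r + s > 0" and le: "(\<Sum>(r, s)\<leftarrow>ps. r + s) \<le> \<iota>"
      by (auto simp: bch_index_def)
    have "length ps \<le> (\<Sum>(r, s)\<leftarrow>ps. r + s)"
      using pos by (induction ps) auto
    moreover have "r + s \<le> (\<Sum>(r, s)\<leftarrow>ps. r + s)" if "(r, s) \<in> set ps" for r s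
      using that by (induction ps) auto
    ultimately show "ps \<in> {ps. set ps \<subseteq> {..\<iota>} \<times> {..\<iota>} \<and> length ps \<le> \<iota>}"
      using le by fastforce
  qed
  show "finite {ps. set ps \<subseteq> {..\<iota>} \<times> {..\<iota>} \<and> length ps \<le> \<iota>}"
    by (intro finite_lists_length_le) auto
qed


subsection \<open>Graded bases, left-invariant fields and homogeneous distances\<close>

text \<open>The vectors \<open>e 1, e 2, \<dots>\<close> list a basis of \<open>H 1\<close>, then one of \<open>H 2\<close>, and so on.\<close>

definition graded_basis ::
  "nat \<Rightarrow> (nat \<Rightarrow> 'a::euclidean_space set) \<Rightarrow> (nat \<Rightarrow> 'a) \<Rightarrow> bool" where
  "graded_basis \<iota> H e \<longleftrightarrow> (\<forall>j\<in>{1..\<iota>}.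
     let B = {(\<Sum>k=1..<j. dim (H k)) <.. (\<Sum>k=1..j. dim (H k))}
     in inj_on e B \<and> independent (e ` B) \<and> span (e ` B) = H j)"

definition left_invariant_field ::
  "nat \<Rightarrow> ('a \<Rightarrow> 'a \<Rightarrow> 'a) \<Rightarrow> ('a::euclidean_space \<Rightarrow> 'a) \<Rightarrow> bool" where
  "left_invariant_field \<iota> br X \<longleftrightarrow>
     (\<forall>x y. frechet_derivative (\<lambda>z. bch \<iota> br x z) (at y) (X y) = X (bch \<iota> br x y))"

definition homogeneous_distance ::
  "nat \<Rightarrow> (nat \<Rightarrow> 'a::euclidean_space set) \<Rightarrow> ('a \<Rightarrow> 'a \<Rightarrow> 'a) \<Rightarrow> ('a \<Rightarrow> 'a \<Rightarrow> real) \<Rightarrow> bool" where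
  "homogeneous_distance \<iota> H br d \<longleftrightarrow>
     Metric_space UNIV d \<and>
     continuous_on UNIV (\<lambda>(x, y). d x y) \<and>
     (\<forall>x y z. d (bch \<iota> br x y) (bch \<iota> br x z) = d y z) \<and>
     (\<forall>r>0. \<forall>x y. d (dilation \<iota> H r x) (dilation \<iota> H r y) = r * d x y)"


section \<open>Lipschitz horizontal vector fields and their integral curves\<close>

text \<open>Here \<open>m\<close> stands for the dimension of \<open>H 1\<close>.\<close>

definition lipschitz_horizontal_field ::
  "('a::euclidean_space \<Rightarrow> 'a \<Rightarrow> real) \<Rightarrow> nat \<Rightarrow> (nat \<Rightarrow> 'a \<Rightarrow> 'a) \<Rightarrow> real \<Rightarrow> 'a set \<Rightarrow>
     (real \<Rightarrow> 'a \<Rightarrow> 'a) \<Rightarrow> bool" where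
  "lipschitz_horizontal_field d m X T \<Omega> b \<longleftrightarrow>
     (\<exists>a :: nat \<Rightarrow> real \<Rightarrow> 'a \<Rightarrow> real.
        (\<forall>t\<in>{0..T}. \<forall>x\<in>\<Omega>. b t x = (\<Sum>i=1..m. a i t x *\<^sub>R X i x)) \<and>
        (\<forall>i\<in>{1..m}. continuous_on ({0..T} \<times> \<Omega>) (\<lambda>(t, x). a i t x)) \<and>
        (\<exists>C>0. \<forall>i\<in>{1..m}. \<forall>t\<in>{0..T}. \<forall>x\<in>\<Omega>. \<forall>y\<in>\<Omega>. \<bar>a i t x - a i t y\<bar> \<le> C * d x y))"

definition is_solution ::
  "real \<Rightarrow> 'a::euclidean_space set \<Rightarrow> (real \<Rightarrow> 'a \<Rightarrow> 'a) \<Rightarrow> (real \<Rightarrow> 'a) \<Rightarrow> bool" where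
  "is_solution T \<Omega> b \<gamma> \<longleftrightarrow>
     continuous_on {0..T} \<gamma> \<and> \<gamma> ` {0..T} \<subseteq> \<Omega> \<and>
     (\<forall>t\<in>{0..T}. ((\<lambda>s. b s (\<gamma> s)) has_integral (\<gamma> t - \<gamma> 0)) {0..t})"

end

theory Submission
  imports Defs
begin

text \<open>
  Since the fields \<open>X i\<close> with \<open>i \<le> m\<close> are independent at \<open>xbar\<close>, the coefficients of \<open>b\<close> vanish
  there, and hence are bounded by \<open>C \<cdot> d x xbar\<close>. Left translation moves \<open>xbar\<close> to \<open>0\<close> and keeps
  the form of the equation. Dilations are automorphisms of the group, so that the \<open>j\<close>-th layer of
  \<open>X i x\<close> is homogeneous of degree \<open>j - 1\<close>; a curve driven by controls of size \<open>d x 0\<close> therefore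
  moves in the \<open>j\<close>-th layer at speed of order \<open>(d x 0)\<^sup>j\<close>, which is the scale of that layer
  for \<open>d\<close>, and cannot leave \<open>0\<close>.
\<close>

declare One_nat_def [simp del]

section \<open>Words in the Baker-Campbell-Hausdorff sum\<close>

text \<open>With \<open>f\<close> a dilation this carries dilations through the product; with
  \<open>f\<close> defined on booleans it exhibits every word as an instance of one fixed pattern of
  \<open>x\<close> and \<open>y\<close> slots.\<close>

lemma bch_word_map: "bch_word (f x) (f y) ps = map f (bch_word x y ps)"
  by (induction ps) (auto simp: bch_word_def)

lemma length_bch_word: "length (bch_word x y ps) = (\<Sum>(r, s)\<leftarrow>ps. r + s)"
  by (induction ps) (auto simp: bch_word_def)

lemma set_bch_word: "set (bch_word x y ps) \<subseteq> {x, y}"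
  using bch_word_map[of "\<lambda>b. if b then x else y" True False ps] by auto

text \<open>Every pair contributes at least 1, so a second pair would already give 2. This isolates
  the linear terms of the product.\<close>

lemma sum_list_pairs_eq_1:
  assumes "\<forall>(r, s)\<in>set ps. r + s > 0" "(\<Sum>(r, s)\<leftarrow>ps. r + s) = (1::nat)"
  shows "ps = [(1, 0)] \<or> ps = [(0, 1)]"
proof (cases ps)
  case (Cons p qs)
  obtain r s where p: "p = (r, s)" by fastforce
  have "qs = []"
    using assms p Cons by (cases qs) auto
  then show ?thesis
    using assms p Cons by auto
qed (use assms in auto)

context homogeneous_group
begin

section \<open>Layer projections and dilations\<close>

text \<open>Without layers the empty sum would make every vector zero, while a Euclidean space has a
  nonzero basis vector.\<close>

lemma iota_pos: "\<iota> \<ge> 1"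
proof (rule ccontr)
  assume "\<not> \<iota> \<ge> 1"
  then have "x = 0" for x :: 'a
    using direct_sum[of x] by auto
  then show False
    using nonzero_Basis[of "SOME i :: 'a. i \<in> Basis"] by blast
qed

lemma layer_part_PiE: "layer_part \<iota> H x \<in> (\<Pi>\<^sub>E j\<in>{1..\<iota>}. H j)"
  and layer_part_sum: "(\<Sum>j=1..\<iota>. layer_part \<iota> H x j) = x"
  using theI'[OF direct_sum[of x]] unfolding layer_part_def by auto

lemma layer_part_mem: "j \<in> {1..\<iota>} \<Longrightarrow> layer_part \<iota> H x j \<in> H j"
  using layer_part_PiE[of x] by (auto simp: PiE_iff)

lemma layer_part_eqI:
  assumes "\<And>j. j \<in> {1..\<iota>} \<Longrightarrow> c j \<in> H j" "x = (\<Sum>j=1..\<iota>. c j)" "j \<in> {1..\<iota>}"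
  shows "layer_part \<iota> H x j = c j"
proof -
  \<comment> \<open>Uniqueness holds among extensional functions, so \<open>c\<close> is first made
    \<open>undefined\<close> off the index set.\<close>
  have "layer_part \<iota> H x = restrict c {1..\<iota>}"
    unfolding layer_part_def
    by (rule the1_equality[OF direct_sum]) (use assms in \<open>auto intro!: sum.cong\<close>)
  then show ?thesis
    using assms by simp
qed

lemma linear_layer_part:
  assumes "j \<in> {1..\<iota>}"
  shows "linear (\<lambda>x. layer_part \<iota> H x j)"
proof (rule linearI)
  show "layer_part \<iota> H (x + y) j = layer_part \<iota> H x j + layer_part \<iota> H y j" for x y
    by (rule layer_part_eqI[OF _ _ assms])
      (auto simp: sum.distrib layer_part_sum intro!: subspace_add layer_subspace layer_part_mem)
  show "layer_part \<iota> H (r *\<^sub>R x) j = r *\<^sub>R layer_part \<iota> H x j" for r x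
    by (rule layer_part_eqI[OF _ _ assms])
      (auto simp: layer_part_sum simp flip: scaleR_sum_right
        intro!: subspace_scale layer_subspace layer_part_mem)
qed

lemma layer_part_dilation:
  assumes "j \<in> {1..\<iota>}"
  shows "layer_part \<iota> H (dilation \<iota> H r x) j = r ^ j *\<^sub>R layer_part \<iota> H x j"
  by (rule layer_part_eqI[OF _ _ assms])
    (auto simp: dilation_def intro!: subspace_scale layer_subspace layer_part_mem)

lemma linear_dilation: "linear (dilation \<iota> H r)"
  unfolding dilation_def
  by (intro linear_compose_sum ballI linear_compose_scale_right linear_layer_part)

text \<open>Degrees beyond \<iota> are included, with both sides zero, because the degree
  \<open>i + j\<close> of a bracket may exceed \<iota>.\<close>

lemma dilation_layer:
  assumes "x \<in> H k" "k \<ge> 1"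
  shows "dilation \<iota> H r x = r ^ k *\<^sub>R x"
proof (cases "k \<le> \<iota>")
  case True
  then have k: "k \<in> {1..\<iota>}"
    using assms by auto
  have "layer_part \<iota> H x j = (if j = k then x else 0)" if "j \<in> {1..\<iota>}" for j
    by (rule layer_part_eqI[OF _ _ that]) (use assms k in \<open>auto intro!: subspace_0 layer_subspace\<close>)
  then have "dilation \<iota> H r x = (\<Sum>j=1..\<iota>. if j = k then r ^ k *\<^sub>R x else 0)"
    unfolding dilation_def by (intro sum.cong) auto
  then show ?thesis
    using k by simp
next
  case False
  then have "x = 0"
    using assms layer_beyond[of k] by auto
  then show ?thesis
    using linear_0[OF linear_dilation] by simp
qed

text \<open>Expand both arguments into layers: on \<open>H i\<close> and \<open>H j\<close> either
  side multiplies the bracket by \<open>r ^ (i + j)\<close>.\<close>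

lemma dilation_br: "dilation \<iota> H r (br x y) = br (dilation \<iota> H r x) (dilation \<iota> H r y)"
proof -
  interpret D: linear "dilation \<iota> H r" by (rule linear_dilation)
  let ?P = "layer_part \<iota> H"
  have *: "br (\<Sum>i=1..\<iota>. f i) (\<Sum>j=1..\<iota>. g j) = (\<Sum>i=1..\<iota>. \<Sum>j=1..\<iota>. br (f i) (g j))" for f g
    using bilinear_sum[OF br_bilinear, of f "{1..\<iota>}" g "{1..\<iota>}"] by (simp add: sum.cartesian_product)
  have "dilation \<iota> H r (br x y) = dilation \<iota> H r (\<Sum>i=1..\<iota>. \<Sum>j=1..\<iota>. br (?P x i) (?P y j))"
    by (simp add: layer_part_sum flip: *)
  also have "\<dots> = (\<Sum>i=1..\<iota>. \<Sum>j=1..\<iota>. dilation \<iota> H r (br (?P x i) (?P y j)))"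
    by (simp add: D.sum)
  also have "\<dots> = (\<Sum>i=1..\<iota>. \<Sum>j=1..\<iota>. br (r ^ i *\<^sub>R ?P x i) (r ^ j *\<^sub>R ?P y j))"
  proof (intro sum.cong refl)
    fix i j assume ij: "i \<in> {1..\<iota>}" "j \<in> {1..\<iota>}"
    then have "br (?P x i) (?P y j) \<in> H (i + j)"
      by (intro br_graded layer_part_mem)
    then show "dilation \<iota> H r (br (?P x i) (?P y j)) = br (r ^ i *\<^sub>R ?P x i) (r ^ j *\<^sub>R ?P y j)"
      using ij by (simp add: dilation_layer bilinear_lmul[OF br_bilinear]
          bilinear_rmul[OF br_bilinear] power_add)
  qed
  also have "\<dots> = br (dilation \<iota> H r x) (dilation \<iota> H r y)"
    by (simp add: dilation_def flip: *)
  finally show ?thesis .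
qed

lemma dilation_nested_bracket:
  "dilation \<iota> H r (nested_bracket br w) = nested_bracket br (map (dilation \<iota> H r) w)"
  by (induction w rule: induct_list012)
    (use linear_0[OF linear_dilation] dilation_br in auto)

lemma dilation_bch:
  "dilation \<iota> H r (bch \<iota> br x y) = bch \<iota> br (dilation \<iota> H r x) (dilation \<iota> H r y)"
  by (simp add: bch_def linear_sum[OF linear_dilation] linear_cmul[OF linear_dilation]
      dilation_nested_bracket bch_word_map)

section \<open>The product along a line through 0\<close>

text \<open>The innermost bracket has parallel arguments and vanishes by alternation; the outer
  brackets then stay zero.\<close>

lemma nested_bracket_multiples:
  assumes "set w \<subseteq> range (\<lambda>c. c *\<^sub>R x)" "length w \<ge> 2"
  shows "nested_bracket br w = 0"
  using assms
proof (induction w rule: induct_list012)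
  case (3 u v w)
  show ?case
  proof (cases "w = []")
    case True
    then show ?thesis
      using 3 by (auto simp: bilinear_lmul[OF br_bilinear] bilinear_rmul[OF br_bilinear] br_alternating)
  next
    case False
    then have "nested_bracket br (v # w) = 0"
      using 3 by (cases w) auto
    then show ?thesis
      by (simp add: bilinear_rzero[OF br_bilinear])
  qed
qed auto

text \<open>Only words of length one survive on a line. This supplies the identity 0 and the inverse
  \<open>- x\<close>.\<close>

lemma bch_multiples: "bch \<iota> br (a *\<^sub>R x) (b *\<^sub>R x) = (a + b) *\<^sub>R x"
proof -
  let ?w = "bch_word (a *\<^sub>R x) (b *\<^sub>R x)"
  have "bch \<iota> br (a *\<^sub>R x) (b *\<^sub>R x) =
      (\<Sum>ps\<in>{[(1, 0)], [(0, 1)]}. bch_coeff ps *\<^sub>R nested_bracket br (?w ps))"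
    unfolding bch_def
  proof (rule sum.mono_neutral_right[OF finite_bch_index])
    show "{[(1, 0)], [(0, 1)]} \<subseteq> bch_index \<iota>"
      using iota_pos by (auto simp: bch_index_def)
    show "\<forall>ps\<in>bch_index \<iota> - {[(1, 0)], [(0, 1)]}. bch_coeff ps *\<^sub>R nested_bracket br (?w ps) = 0"
    proof
      fix ps assume ps: "ps \<in> bch_index \<iota> - {[(1, 0)], [(0, 1)]}"
      then have "(\<Sum>(r, s)\<leftarrow>ps. r + s) \<noteq> 1"
        using sum_list_pairs_eq_1[of ps] by (auto simp: bch_index_def)
      moreover have "(\<Sum>(r, s)\<leftarrow>ps. r + s) \<noteq> 0"
        using ps by (cases ps) (auto simp: bch_index_def)
      ultimately have "length (?w ps) \<ge> 2"
        unfolding length_bch_word by linarith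
      moreover have "set (?w ps) \<subseteq> range (\<lambda>c. c *\<^sub>R x)"
        using set_bch_word[of "a *\<^sub>R x" "b *\<^sub>R x" ps] by blast
      ultimately show "bch_coeff ps *\<^sub>R nested_bracket br (?w ps) = 0"
        using nested_bracket_multiples by simp
    qed
  qed
  also have "\<dots> = (a + b) *\<^sub>R x"
    by (simp add: bch_coeff_def bch_word_def scaleR_left_distrib One_nat_def)
  finally show ?thesis .
qed

lemma bch_zero_right: "bch \<iota> br x 0 = x"
  using bch_multiples[of 1 x 0] by simp

lemma bch_minus_left: "bch \<iota> br (- x) x = 0"
  using bch_multiples[of "-1" x 1] by simp

section \<open>Differentials of left translations and left-invariant fields\<close>

text \<open>The pattern \<open>w\<close> marks the slots of \<open>x\<close> by \<open>True\<close>;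
  induction uses the Leibniz rule for \<open>br\<close>. Continuity of the bracket in
  \<open>x\<close> is carried along because the bracket itself reappears in the derivative.\<close>

lemma nested_bracket_has_derivative:
  "\<exists>F'. \<forall>x y. ((\<lambda>z. nested_bracket br (map (\<lambda>b. if b then x else z) w)) has_derivative F' x y) (at y)
      \<and> continuous_on UNIV (\<lambda>x. nested_bracket br (map (\<lambda>b. if b then x else y) w))
      \<and> (\<forall>v. continuous_on UNIV (\<lambda>x. F' x y v))"
proof -
  interpret B: bounded_bilinear br
    using br_bilinear by (simp add: bilinear_conv_bounded_bilinear)
  show ?thesis
  proof (induction w rule: induct_list012)
    case 1
    show ?case by (rule exI[of _ "\<lambda>x y v. 0"]) auto
  next
    case (2 b)
    show ?case by (rule exI[of _ "\<lambda>x y v. if b then 0 else v"], cases b) auto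
  next
    case (3 b c w)
    let ?g = "\<lambda>x y. nested_bracket br (map (\<lambda>b. if b then x else y) (c # w))"
    obtain F' where F': "\<And>x y. (?g x has_derivative F' x y) (at y)"
      "\<And>y. continuous_on UNIV (\<lambda>x. ?g x y)" "\<And>y v. continuous_on UNIV (\<lambda>x. F' x y v)"
      using "3.IH"(2) by blast
    show ?case
    proof (rule exI[of _ "\<lambda>x y v. if b then br x (F' x y v) else br y (F' x y v) + br v (?g x y)"],
        intro allI conjI)
      fix x y v
      have eq: "nested_bracket br (map (\<lambda>b. if b then x else y) (b # c # w)) =
          br (if b then x else y) (?g x y)" for x y
        by simp
      show "((\<lambda>z. nested_bracket br (map (\<lambda>b. if b then x else z) (b # c # w))) has_derivative
          (\<lambda>v. if b then br x (F' x y v) else br y (F' x y v) + br v (?g x y))) (at y)"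
        unfolding eq using B.FDERIV[OF has_derivative_const[of x] F'(1)]
          B.FDERIV[OF has_derivative_ident F'(1)] by (cases b) (simp_all add: B.zero_left)
      show "continuous_on UNIV (\<lambda>x. nested_bracket br (map (\<lambda>b. if b then x else y) (b # c # w)))"
        unfolding eq by (cases b) (simp_all only: if_True if_False,
            (intro B.continuous_on F' continuous_on_id continuous_on_const)+)
      show "continuous_on UNIV (\<lambda>x. if b then br x (F' x y v) else br y (F' x y v) + br v (?g x y))"
        by (cases b) (simp_all only: if_True if_False,
            (intro continuous_on_add B.continuous_on F' continuous_on_id continuous_on_const)+)
    qed
  qed
qed

lemma bch_has_derivative:
  obtains F' where "\<And>x y. (bch \<iota> br x has_derivative F' x y) (at y)"
    "\<And>y v. continuous_on UNIV (\<lambda>x. F' x y v)"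
proof -
  let ?w = "\<lambda>x y ps. nested_bracket br (bch_word x y ps)"
  have "\<exists>F'. \<forall>x y. ((\<lambda>z. ?w x z ps) has_derivative F' x y) (at y)
      \<and> (\<forall>v. continuous_on UNIV (\<lambda>x. F' x y v))" for ps
  proof -
    have word: "bch_word x y ps = map (\<lambda>b. if b then x else y) (bch_word True False ps)" for x y :: 'a
      using bch_word_map[of "\<lambda>b. if b then x else y" True False ps] by simp
    show ?thesis
      unfolding word using nested_bracket_has_derivative[of "bch_word True False ps"] by blast
  qed
  then obtain G where G: "\<And>ps x y. ((\<lambda>z. ?w x z ps) has_derivative G ps x y) (at y)"
    "\<And>ps y v. continuous_on UNIV (\<lambda>x. G ps x y v)"
    by metis
  show ?thesis
  proof
    show "(bch \<iota> br x has_derivative (\<lambda>v. \<Sum>ps\<in>bch_index \<iota>. bch_coeff ps *\<^sub>R G ps x y v)) (at y)" for x y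
      unfolding bch_def[abs_def] by (intro has_derivative_sum has_derivative_scaleR_right G)
    show "continuous_on UNIV (\<lambda>x. \<Sum>ps\<in>bch_index \<iota>. bch_coeff ps *\<^sub>R G ps x y v)" for y v
      by (intro continuous_intros G)
  qed
qed

lemma bch_differentiable: "bch \<iota> br x differentiable at y"
  using bch_has_derivative by (metis differentiableI)

text \<open>Left invariance at the identity gives \<open>X x\<close> as the differential at 0 of
  left translation by \<open>x\<close>, applied to \<open>X 0\<close>; this depends continuously on
  \<open>x\<close>.\<close>

lemma left_invariant_field_continuous:
  assumes "left_invariant_field \<iota> br X"
  shows "continuous_on UNIV X"
proof -
  obtain F' where F': "\<And>x y. (bch \<iota> br x has_derivative F' x y) (at y)"
    "\<And>y v. continuous_on UNIV (\<lambda>x. F' x y v)"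
    using bch_has_derivative by blast
  have "X x = F' x 0 (X 0)" for x
    using assms frechet_derivative_at[OF F'(1)] bch_zero_right
    unfolding left_invariant_field_def by metis
  then have "X = (\<lambda>x. F' x 0 (X 0))"
    by blast
  then show ?thesis
    using F'(2) by metis
qed

text \<open>Since dilations are automorphisms, \<open>?D (bch \<iota> br x z)\<close> can be
  differentiated at \<open>z = 0\<close> in two ways. Evaluating both on \<open>X 0\<close>, which
  lies in the first layer and is scaled by \<open>r\<close>, gives the identity.\<close>

lemma left_invariant_field_dilation:
  assumes X: "left_invariant_field \<iota> br X" "X 0 \<in> H 1"
  shows "r *\<^sub>R X (dilation \<iota> H r x) = dilation \<iota> H r (X x)"
proof -
  let ?D = "dilation \<iota> H r"
  obtain F' where F': "\<And>x y. (bch \<iota> br x has_derivative F' x y) (at y)"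
    and "\<And>y v. continuous_on UNIV (\<lambda>x. F' x y v)"
    using bch_has_derivative by blast
  have X_eq: "X x = F' x 0 (X 0)" for x
    using X(1) frechet_derivative_at[OF F'(1)] bch_zero_right
    unfolding left_invariant_field_def by metis
  have D: "(?D has_derivative ?D) F" for F
    using linear_dilation by (simp add: linear_conv_bounded_linear bounded_linear_imp_has_derivative)
  have 1: "((\<lambda>z. ?D (bch \<iota> br x z)) has_derivative (\<lambda>v. ?D (F' x 0 v))) (at 0)"
    using has_derivative_compose[OF F' D] by blast
  have "((\<lambda>z. bch \<iota> br (?D x) (?D z)) has_derivative (\<lambda>v. F' (?D x) (?D 0) (?D v))) (at 0)"
    using has_derivative_compose[OF D F'] by blast
  then have "((\<lambda>z. ?D (bch \<iota> br x z)) has_derivative (\<lambda>v. F' (?D x) 0 (?D v))) (at 0)"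
    by (simp add: dilation_bch linear_0[OF linear_dilation])
  then have "(\<lambda>v. F' (?D x) 0 (?D v)) = (\<lambda>v. ?D (F' x 0 v))"
    using 1 has_derivative_unique by blast
  then have "F' (?D x) 0 (?D (X 0)) = ?D (X x)"
    using X_eq by metis
  moreover have "?D (X 0) = r *\<^sub>R X 0"
    using dilation_layer[OF X(2)] by simp
  moreover have "F' (?D x) 0 (r *\<^sub>R X 0) = r *\<^sub>R X (?D x)"
    using linear_cmul[OF has_derivative_linear[OF F']] X_eq by metis
  ultimately show ?thesis
    by simp
qed

end

section \<open>Scaling estimates for a homogeneous distance\<close>

locale homogeneous_metric_group = homogeneous_group +
  fixes d :: "'a::euclidean_space \<Rightarrow> 'a \<Rightarrow> real"
  assumes hd: "homogeneous_distance \<iota> H br d"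
begin

sublocale Metric_space UNIV d
  using hd by (simp add: homogeneous_distance_def)

lemma d_continuous_zero: "continuous_on UNIV (\<lambda>x. d x 0)"
proof -
  have "continuous_on UNIV (\<lambda>(x, y). d x y)"
    using hd by (simp add: homogeneous_distance_def)
  then have "continuous_on UNIV ((\<lambda>(x, y). d x y) \<circ> (\<lambda>x. (x, 0)))"
    by (intro continuous_on_compose continuous_intros) (auto elim: continuous_on_subset)
  then show ?thesis
    by (simp add: o_def)
qed

lemma d_dilation: "r > 0 \<Longrightarrow> d (dilation \<iota> H r x) 0 = r * d x 0"
  using hd linear_0[OF linear_dilation, of r] unfolding homogeneous_distance_def by metis

text \<open>Take \<open>m\<close> to be the minimum of the distance to 0 over the unit sphere. A
  point of norm above 1 is moved onto the sphere by a dilation with factor at most 1, so its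
  distance to 0 is at least \<open>m\<close>.\<close>

lemma d_ball_bounded: obtains m where "m > 0" "\<And>x. d x 0 < m \<Longrightarrow> norm x \<le> 1"
proof -
  have "sphere (0::'a) 1 \<noteq> {}"
    by simp
  then obtain z where z: "z \<in> sphere (0::'a) 1" "\<And>x. x \<in> sphere 0 1 \<Longrightarrow> d z 0 \<le> d x 0"
    using continuous_attains_inf[OF compact_sphere, of 0 1 "\<lambda>x. d x 0"]
      continuous_on_subset[OF d_continuous_zero] by auto
  show ?thesis
  proof
    have "z \<noteq> 0"
      using z by auto
    then show "d z 0 > 0"
      using mdist_pos_eq by auto
    show "norm x \<le> 1" if x: "d x 0 < d z 0" for x
    proof (rule ccontr)
      assume n: "\<not> norm x \<le> 1"
      \<comment> \<open>Intermediate value argument: all exponents are at least 1, so the factor 0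
        sends \<open>x\<close> to 0, while the factor 1 fixes it.\<close>
      let ?f = "\<lambda>s. norm (dilation \<iota> H s x)"
      have "?f 0 = 0"
        unfolding dilation_def by (auto simp: intro!: sum.neutral)
      moreover have "?f 1 = norm x"
        by (simp add: dilation_def layer_part_sum)
      moreover have "continuous_on {0..1} ?f"
        unfolding dilation_def by (intro continuous_intros)
      ultimately obtain s where s: "0 \<le> s" "s \<le> 1" "?f s = 1"
        using IVT'[of ?f 0 1 1] n by auto
      with \<open>?f 0 = 0\<close> have "s > 0"
        by (cases "s = 0") auto
      have "d z 0 \<le> s * d x 0"
        using z(2)[of "dilation \<iota> H s x"] s d_dilation[OF \<open>s > 0\<close>] by simp
      also have "\<dots> \<le> d x 0"
        using s by (simp add: mult_left_le_one_le)
      finally show False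
        using x by simp
    qed
  qed
qed

text \<open>Compactness bounds the field near 0, and its homogeneity of degree \<open>j - 1\<close>
  spreads the bound to all scales. The free radius \<open>\<rho>\<close> avoids a separate case for
  \<open>x = 0\<close>.\<close>

lemma left_invariant_field_bound:
  assumes X: "left_invariant_field \<iota> br X" "X 0 \<in> H 1" and j: "j \<in> {1..\<iota>}"
  shows "\<exists>K\<ge>0. \<forall>x \<rho>. \<rho> > 0 \<and> d x 0 \<le> \<rho> \<longrightarrow> norm (layer_part \<iota> H (X x) j) \<le> K * \<rho> ^ (j - 1)"
proof -
  obtain m where m: "m > 0" "\<And>x. d x 0 < m \<Longrightarrow> norm x \<le> 1"
    using d_ball_bounded by blast
  have "continuous_on (cball 0 1) (\<lambda>x. layer_part \<iota> H (X x) j)"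
    using linear_continuous_on_compose[OF left_invariant_field_continuous[OF X(1)]
        linear_layer_part[OF j]] continuous_on_subset by blast
  then have "bounded ((\<lambda>x. layer_part \<iota> H (X x) j) ` cball 0 1)"
    using compact_continuous_image compact_imp_bounded compact_cball by blast
  then obtain K where K: "K > 0" "\<And>x. norm x \<le> 1 \<Longrightarrow> norm (layer_part \<iota> H (X x) j) \<le> K"
    unfolding bounded_pos by auto
  show ?thesis
  proof (intro exI[of _ "K * (2 / m) ^ (j - 1)"] conjI allI impI)
    show "K * (2 / m) ^ (j - 1) \<ge> 0"
      using K m by simp
    fix x \<rho> assume *: "\<rho> > 0 \<and> d x 0 \<le> \<rho>"
    \<comment> \<open>The factor 2 brings the dilated point within distance \<open>m / 2\<close>,
      strictly inside the ball controlled by \<open>m\<close>.\<close>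
    define s where "s = m / (2 * \<rho>)"
    have s: "s > 0"
      using m * by (simp add: s_def)
    let ?u = "layer_part \<iota> H (X x) j"
    have "s * d x 0 \<le> s * \<rho>"
      using * s by simp
    also have "\<dots> < m"
      using * m by (simp add: s_def)
    finally have "norm (dilation \<iota> H s x) \<le> 1"
      using m d_dilation[OF s] by simp
    then have le: "norm (layer_part \<iota> H (X (dilation \<iota> H s x)) j) \<le> K"
      by (rule K)
    \<comment> \<open>Layer \<open>j\<close> gains \<open>s ^ j\<close> from the dilation;
      cancelling the \<open>s\<close> on the left leaves the degree \<open>j - 1\<close>.\<close>
    have "s *\<^sub>R layer_part \<iota> H (X (dilation \<iota> H s x)) j = s ^ j *\<^sub>R ?u"
      using layer_part_dilation[OF j] left_invariant_field_dilation[OF X]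
        linear_cmul[OF linear_layer_part[OF j]] by metis
    also have "\<dots> = s *\<^sub>R (s ^ (j - 1) *\<^sub>R ?u)"
      using j by (cases j) auto
    finally have "layer_part \<iota> H (X (dilation \<iota> H s x)) j = s ^ (j - 1) *\<^sub>R ?u"
      using s scaleR_cancel_left by (metis less_irrefl)
    then have "s ^ (j - 1) * norm ?u \<le> K"
      using le s by simp
    then have "norm ?u \<le> K * (1 / s) ^ (j - 1)"
      using s by (simp add: field_simps)
    also have "(1 / s) ^ (j - 1) = (2 / m) ^ (j - 1) * \<rho> ^ (j - 1)"
      by (simp add: s_def flip: power_mult_distrib)
    finally show "norm ?u \<le> K * (2 / m) ^ (j - 1) * \<rho> ^ (j - 1)"
      by (simp only: mult.assoc)
  qed
qed

text \<open>Dilating by \<open>1 / \<rho>\<close> turns the layerwise hypothesis into Euclidean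
  smallness, where continuity of the distance at 0 applies.\<close>

lemma d_small_layers:
  obtains c where "c > 0"
    "\<And>x \<rho>. \<rho> > 0 \<Longrightarrow> (\<And>j. j \<in> {1..\<iota>} \<Longrightarrow> norm (layer_part \<iota> H x j) \<le> c * \<rho> ^ j) \<Longrightarrow> d x 0 \<le> \<rho> / 2"
proof -
  obtain e where e: "e > 0" "\<And>x. norm x < e \<Longrightarrow> d x 0 < 1 / 2"
    using d_continuous_zero[unfolded continuous_on_iff, rule_format, of 0 "1 / 2"]
    by (auto simp: dist_norm)
  show ?thesis
  proof
    \<comment> \<open>With this constant the sum of the \<iota> layer bounds stays strictly below
      \<open>e\<close>.\<close>
    show "e / (\<iota> + 1) > 0"
      using e by simp
    fix x \<rho> assume r: "\<rho> > (0::real)"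
      and le: "\<And>j. j \<in> {1..\<iota>} \<Longrightarrow> norm (layer_part \<iota> H x j) \<le> e / (\<iota> + 1) * \<rho> ^ j"
    let ?y = "dilation \<iota> H (1 / \<rho>) x"
    have "norm ?y \<le> (\<Sum>j=1..\<iota>. e / (\<iota> + 1))"
      unfolding dilation_def
    proof (rule sum_norm_le)
      fix j assume "j \<in> {1..\<iota>}"
      from le[OF this] show "norm ((1 / \<rho>) ^ j *\<^sub>R layer_part \<iota> H x j) \<le> e / (\<iota> + 1)"
        using r by (simp add: field_simps)
    qed
    also have "\<dots> < e"
      using e by (simp add: field_simps)
    finally have "d ?y 0 < 1 / 2"
      by (rule e)
    then show "d x 0 \<le> \<rho> / 2"
      using d_dilation[of "1 / \<rho>" x] r by (simp add: field_simps)
  qed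
qed

section \<open>Curves driven by controls of the size of the distance to 0\<close>

text \<open>
  If \<open>\<rho>\<close> is the maximum of \<open>d (\<eta> t) 0\<close> over a time interval of length \<open>h\<close> starting at a zero of
  \<open>\<eta>\<close>, then the \<open>j\<close>-th layer of \<open>\<eta>'\<close> is \<open>O(\<rho> \<cdot> \<rho>\<^sup>j\<^sup>-\<^sup>1)\<close>, so that the \<open>j\<close>-th layer of \<open>\<eta>\<close> is
  \<open>O(h \<rho>\<^sup>j)\<close>; for \<open>h\<close> small this forces \<open>\<rho> \<le> \<rho> / 2\<close>.
\<close>

lemma horizontal_curve_zero:
  assumes I: "finite I" "\<And>i. i \<in> I \<Longrightarrow> left_invariant_field \<iota> br (X i) \<and> X i 0 \<in> H 1"
    and deriv: "\<And>t. t \<in> {0..T} \<Longrightarrow>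
      (\<eta> has_vector_derivative (\<Sum>i\<in>I. u i t *\<^sub>R X i (\<eta> t))) (at t within {0..T})"
    and u: "\<And>i t. i \<in> I \<Longrightarrow> t \<in> {0..T} \<Longrightarrow> \<bar>u i t\<bar> \<le> C * d (\<eta> t) 0"
    and C: "C \<ge> 0" and zero: "\<eta> 0 = 0" and t: "t \<in> {0..T}"
  shows "\<eta> t = 0"
proof -
  let ?P = "layer_part \<iota> H"
  obtain c where c: "c > 0"
    "\<And>x \<rho>. \<rho> > 0 \<Longrightarrow> (\<And>j. j \<in> {1..\<iota>} \<Longrightarrow> norm (?P x j) \<le> c * \<rho> ^ j) \<Longrightarrow> d x 0 \<le> \<rho> / 2"
    using d_small_layers by blast
  have "\<forall>i\<in>I. \<forall>j\<in>{1..\<iota>}. \<exists>K\<ge>0. \<forall>x \<rho>. \<rho> > 0 \<and> d x 0 \<le> \<rho> \<longrightarrow>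
      norm (?P (X i x) j) \<le> K * \<rho> ^ (j - 1)"
    using left_invariant_field_bound I by blast
  then obtain K where K: "\<And>i j. i \<in> I \<Longrightarrow> j \<in> {1..\<iota>} \<Longrightarrow> K i j \<ge> 0"
    "\<And>i j x \<rho>. i \<in> I \<Longrightarrow> j \<in> {1..\<iota>} \<Longrightarrow> \<rho> > 0 \<Longrightarrow> d x 0 \<le> \<rho> \<Longrightarrow>
      norm (?P (X i x) j) \<le> K i j * \<rho> ^ (j - 1)"
    by metis
  \<comment> \<open>One constant dominating the speed of every layer.\<close>
  define L where "L = (\<Sum>j=1..\<iota>. \<Sum>i\<in>I. C * K i j)"
  have L0: "L \<ge> 0"
    unfolding L_def using K C by (intro sum_nonneg) auto
  have L: "(\<Sum>i\<in>I. C * K i j) \<le> L" if "j \<in> {1..\<iota>}" for j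
    unfolding L_def
    by (rule member_le_sum[OF that, of "\<lambda>j. \<Sum>i\<in>I. C * K i j"]) (use K C in \<open>auto intro!: sum_nonneg\<close>)
  \<comment> \<open>Chosen so that \<open>L * h \<le> c\<close>, with \<open>L + 1\<close> keeping
    the quotient defined. It does not depend on the starting time, so finitely many steps cover the
    interval.\<close>
  define h where "h = c / (L + 1)"
  have h: "h > 0"
    using c L0 by (simp add: h_def)
  have hL: "L * h \<le> c"
    using c L0 by (simp add: h_def field_simps)
  have cont: "continuous_on {0..T} \<eta>"
    using deriv has_vector_derivative_continuous unfolding continuous_on_eq_continuous_within by blast
  have step: "\<eta> t = 0"
    if t0: "t0 \<in> {0..T}" "\<eta> t0 = 0" and t: "t \<in> {t0..min T (t0 + h)}" for t0 t
  proof -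
    define S where "S = {t0..min T (t0 + h)}"
    have S: "S \<subseteq> {0..T}" "t0 \<in> S" "convex S" "compact S"
      using t0 h by (auto simp: S_def)
    have "continuous_on S (\<lambda>t. d (\<eta> t) 0)"
      using continuous_on_compose2[OF d_continuous_zero continuous_on_subset[OF cont S(1)]] by simp
    then obtain z where z: "z \<in> S" "\<And>s. s \<in> S \<Longrightarrow> d (\<eta> s) 0 \<le> d (\<eta> z) 0"
      using continuous_attains_sup[OF S(4)] S(2) by blast
    define \<rho> where "\<rho> = d (\<eta> z) 0"
    have "\<rho> = 0"
    proof (rule ccontr)
      assume "\<rho> \<noteq> 0"
      then have \<rho>: "\<rho> > 0"
        unfolding \<rho>_def using nonneg[of "\<eta> z" 0] by linarith
      have "d (\<eta> z) 0 \<le> \<rho> / 2"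
      proof (rule c(2)[OF \<rho>])
        fix j assume j: "j \<in> {1..\<iota>}"
        let ?f' = "\<lambda>s. \<Sum>i\<in>I. u i s *\<^sub>R ?P (X i (\<eta> s)) j"
        have bl: "bounded_linear (\<lambda>x. ?P x j)"
          using linear_layer_part[OF j] by (simp add: linear_conv_bounded_linear)
        have f': "((\<lambda>s. ?P (\<eta> s) j) has_vector_derivative ?f' s) (at s within S)" if "s \<in> S" for s
        proof -
          have "(\<eta> has_vector_derivative (\<Sum>i\<in>I. u i s *\<^sub>R X i (\<eta> s))) (at s within S)"
            using deriv that S(1) has_vector_derivative_within_subset by blast
          from bounded_linear.has_vector_derivative[OF bl this] show ?thesis
            by (simp add: linear_sum[OF linear_layer_part[OF j]] linear_cmul[OF linear_layer_part[OF j]])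
        qed
        have bound: "norm (?f' s) \<le> L * \<rho> ^ j" if "s \<in> S" for s
        proof -
          have s: "d (\<eta> s) 0 \<le> \<rho>" "s \<in> {0..T}"
            using z that S by (auto simp: \<rho>_def)
          have "norm (?f' s) \<le> (\<Sum>i\<in>I. C * K i j * \<rho> ^ j)"
          proof (rule sum_norm_le)
            fix i assume i: "i \<in> I"
            have "\<bar>u i s\<bar> \<le> C * \<rho>"
              using u[OF i s(2)] mult_left_mono[OF s(1) C] by linarith
            \<comment> \<open>The control contributes one factor \<open>\<rho>\<close> and the field
              \<open>j - 1\<close> of them, together \<open>\<rho> ^ j\<close>.\<close>
            then have "norm (u i s *\<^sub>R ?P (X i (\<eta> s)) j) \<le> (C * \<rho>) * (K i j * \<rho> ^ (j - 1))"
              using K(2)[OF i j \<rho> s(1)] C \<rho> by (simp add: mult_mono)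
            also have "\<dots> = C * K i j * \<rho> ^ j"
              using j by (cases j) auto
            finally show "norm (u i s *\<^sub>R ?P (X i (\<eta> s)) j) \<le> C * K i j * \<rho> ^ j" .
          qed
          also have "\<dots> \<le> L * \<rho> ^ j"
            using L[OF j] \<rho> by (simp add: mult_right_mono flip: sum_distrib_right)
          finally show ?thesis .
        qed
        \<comment> \<open>Mean value inequality on the convex set \<open>S\<close>, between
          \<open>t0\<close> and the maximum point \<open>z\<close>.\<close>
        have "norm (?P (\<eta> z) j - ?P (\<eta> t0) j) \<le> L * \<rho> ^ j * norm (z - t0)"
        proof (rule differentiable_bound[OF S(3) _ _ z(1) S(2)])
          fix s assume s: "s \<in> S"
          show "((\<lambda>s. ?P (\<eta> s) j) has_derivative (\<lambda>r. r *\<^sub>R ?f' s)) (at s within S)"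
            using f'[OF s] by (simp add: has_vector_derivative_def)
          show "onorm (\<lambda>r. r *\<^sub>R ?f' s) \<le> L * \<rho> ^ j"
          proof (rule onorm_le)
            show "norm (r *\<^sub>R ?f' s) \<le> L * \<rho> ^ j * norm r" for r :: real
              using mult_left_mono[OF bound[OF s], of "\<bar>r\<bar>"] by (simp add: mult.commute)
          qed
        qed
        also have "\<dots> \<le> L * \<rho> ^ j * h"
          using z(1) L0 \<rho> by (intro mult_left_mono) (auto simp: S_def)
        also have "\<dots> \<le> c * \<rho> ^ j"
          using mult_right_mono[OF hL, of "\<rho> ^ j"] \<rho> by (simp add: mult_ac)
        finally show "norm (?P (\<eta> z) j) \<le> c * \<rho> ^ j"
          using t0(2) linear_0[OF linear_layer_part[OF j]] by simp
      qed
      then show False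
        using \<rho> unfolding \<rho>_def by linarith
    qed
    then have "d (\<eta> t) 0 = 0"
      using z(2)[of t] t nonneg[of "\<eta> t" 0] by (simp add: \<rho>_def S_def)
    then show ?thesis
      by simp
  qed
  \<comment> \<open>Vanishing propagates by one step of length \<open>h\<close> at a time, truncated
    at \<open>T\<close>.\<close>
  have "\<forall>t\<in>{0..min T (real n * h)}. \<eta> t = 0" for n
  proof (induction n)
    case 0
    then show ?case
      using zero by auto
  next
    case (Suc n)
    show ?case
    proof
      fix t assume t: "t \<in> {0..min T (real (Suc n) * h)}"
      show "\<eta> t = 0"
      proof (cases "t \<le> real n * h")
        case True
        then show ?thesis
          using Suc t by auto
      next
        case False
        then have "\<eta> (real n * h) = 0"
          using Suc t h by auto
        then show ?thesis
          using step[of "real n * h" t] False t h by (auto simp: algebra_simps)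
      qed
    qed
  qed
  moreover obtain n where "T < real n * h"
    using reals_Archimedean3[OF h] by blast
  ultimately show ?thesis
    using t by (metis atLeastAtMost_iff min.absorb1 less_imp_le)
qed

end

section \<open>Reduction to the identity by left translation\<close>

theorem corollary4p2:
  fixes \<iota> :: nat
    and H :: "nat \<Rightarrow> 'a::euclidean_space set"
    and br :: "'a \<Rightarrow> 'a \<Rightarrow> 'a"
    and e :: "nat \<Rightarrow> 'a"
    and X :: "nat \<Rightarrow> 'a \<Rightarrow> 'a"
    and d :: "'a \<Rightarrow> 'a \<Rightarrow> real"
    and \<Omega> :: "'a set"
    and T :: real
    and b :: "real \<Rightarrow> 'a \<Rightarrow> 'a"
    and xbar :: 'a
  assumes "homogeneous_group \<iota> H br"
    and "graded_basis \<iota> H e"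
    and "\<And>i. i \<in> {1..DIM('a)} \<Longrightarrow> left_invariant_field \<iota> br (X i) \<and> X i 0 = e i"
    and "homogeneous_distance \<iota> H br d"
    and "open \<Omega>"
    and "T > 0"
    and "lipschitz_horizontal_field d (dim (H 1)) X T \<Omega> b"
    and "xbar \<in> \<Omega>"
    and "\<forall>t\<in>{0..T}. b t xbar = 0"
  shows "is_solution T \<Omega> b (\<lambda>t. xbar) \<and>
    (\<forall>\<gamma>. is_solution T \<Omega> b \<gamma> \<and> \<gamma> 0 = xbar \<longrightarrow> (\<forall>t\<in>{0..T}. \<gamma> t = xbar))"
proof (intro conjI allI impI ballI)
  show "is_solution T \<Omega> b (\<lambda>t. xbar)"
    unfolding is_solution_def using assms(8,9)
    by (auto intro!: has_integral_is_0)
next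
  fix \<gamma> t assume sol: "is_solution T \<Omega> b \<gamma> \<and> \<gamma> 0 = xbar" and t: "t \<in> {0..T}"
  interpret homogeneous_metric_group \<iota> H br d
    using assms(1,4) by (simp add: homogeneous_metric_group_def homogeneous_metric_group_axioms_def)
  define m where "m = dim (H 1)"
  have X: "left_invariant_field \<iota> br (X i)" "X i 0 = e i" if "i \<in> {1..m}" for i
    using assms(3)[of i] that dim_subset_UNIV[of "H 1"] by (auto simp: m_def)
  have basis: "inj_on e {1..m}" "independent (e ` {1..m})" "span (e ` {1..m}) = H 1"
  proof -
    \<comment> \<open>For the first layer the lower sum of dimensions is empty, so the index block
      of the graded basis starts just after 0.\<close>
    have "{0<..m} = {1..m}"
      by auto
    then show "inj_on e {1..m}" "independent (e ` {1..m})" "span (e ` {1..m}) = H 1"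
      using assms(2) iota_pos unfolding graded_basis_def m_def by (auto simp: Let_def dest!: bspec[of _ _ 1])
  qed
  obtain a C where b: "\<And>t x. t \<in> {0..T} \<Longrightarrow> x \<in> \<Omega> \<Longrightarrow> b t x = (\<Sum>i=1..m. a i t x *\<^sub>R X i x)"
    and a: "\<And>i. i \<in> {1..m} \<Longrightarrow> continuous_on ({0..T} \<times> \<Omega>) (\<lambda>(t, x). a i t x)"
    and C: "C > 0" "\<And>i t x y. i \<in> {1..m} \<Longrightarrow> t \<in> {0..T} \<Longrightarrow> x \<in> \<Omega> \<Longrightarrow> y \<in> \<Omega> \<Longrightarrow>
      \<bar>a i t x - a i t y\<bar> \<le> C * d x y"
    using assms(7) unfolding lipschitz_horizontal_field_def m_def by blast
  have \<gamma>: "continuous_on {0..T} \<gamma>" "\<And>s. s \<in> {0..T} \<Longrightarrow> \<gamma> s \<in> \<Omega>"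
    "\<And>s. s \<in> {0..T} \<Longrightarrow> ((\<lambda>s. b s (\<gamma> s)) has_integral (\<gamma> s - xbar)) {0..s}"
    using sol unfolding is_solution_def by auto
  \<comment> \<open>The left translation that takes \<open>xbar\<close> to 0.\<close>
  let ?L = "bch \<iota> br (- xbar)"
  let ?DL = "\<lambda>y. frechet_derivative ?L (at y)"
  have DL: "(?L has_derivative ?DL y) (at y)" for y
    using bch_differentiable by (simp add: frechet_derivative_works)
  note lin_DL = has_derivative_linear[OF DL]
  \<comment> \<open>Left invariance: translation moves the base point of the frame and leaves the
    coefficients unchanged.\<close>
  have DL_X: "?DL y (\<Sum>i=1..m. u i *\<^sub>R X i y) = (\<Sum>i=1..m. u i *\<^sub>R X i (?L y))" for y u
  proof -
    have "?DL y (X i y) = X i (?L y)" if "i \<in> {1..m}" for i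
      using X(1)[OF that] by (simp add: left_invariant_field_def)
    then show ?thesis
      by (simp add: linear_sum[OF lin_DL] linear_cmul[OF lin_DL])
  qed
  \<comment> \<open>The zero vector \<open>b s xbar\<close> is pushed to the identity, where the
    frame is the independent family \<open>e\<close>.\<close>
  have a_xbar: "a i s xbar = 0" if s: "s \<in> {0..T}" and i: "i \<in> {1..m}" for s i
  proof -
    have "0 = ?DL xbar (b s xbar)"
      using assms(9) s linear_0[OF lin_DL] by simp
    also have "\<dots> = (\<Sum>i=1..m. a i s xbar *\<^sub>R e i)"
      using b[OF s assms(8)] DL_X X(2) by (simp add: bch_minus_left)
    also have "\<dots> = (\<Sum>v\<in>e ` {1..m}. a (the_inv_into {1..m} e v) s xbar *\<^sub>R v)"
      using basis(1) by (simp add: sum.reindex the_inv_into_f_f)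
    finally have "a (the_inv_into {1..m} e (e i)) s xbar = 0"
      using independentD[OF basis(2) _ order_refl,
          of "\<lambda>v. a (the_inv_into {1..m} e v) s xbar" "e i"] i by simp
    then show ?thesis
      using i basis(1) by (simp add: the_inv_into_f_f)
  qed
  have L_d: "d (?L (\<gamma> s)) 0 = d (\<gamma> s) xbar" for s
    using assms(4) bch_minus_left[of xbar] unfolding homogeneous_distance_def by metis
  \<comment> \<open>A continuous integrand allows the integral equation to be differentiated at
    every time, one-sidedly at the endpoints.\<close>
  have "continuous_on {0..T} (\<lambda>s. \<Sum>i=1..m. a i s (\<gamma> s) *\<^sub>R X i (\<gamma> s))"
  proof (intro continuous_on_sum continuous_on_scaleR)
    fix i assume i: "i \<in> {1..m}"
    have "continuous_on {0..T} (\<lambda>s. (s, \<gamma> s))"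
      using \<gamma>(1) by (intro continuous_intros)
    moreover have "(\<lambda>s. (s, \<gamma> s)) ` {0..T} \<subseteq> {0..T} \<times> \<Omega>"
      using \<gamma>(2) by auto
    ultimately show "continuous_on {0..T} (\<lambda>s. a i s (\<gamma> s))"
      using continuous_on_compose2[OF a[OF i], of "{0..T}" "\<lambda>s. (s, \<gamma> s)"] by simp
    show "continuous_on {0..T} (\<lambda>s. X i (\<gamma> s))"
      using continuous_on_compose2[OF left_invariant_field_continuous[OF X(1)[OF i]] \<gamma>(1)] by simp
  qed
  then have b_cont: "continuous_on {0..T} (\<lambda>s. b s (\<gamma> s))"
    using b \<gamma>(2) by (subst continuous_on_cong[OF refl]) auto
  have \<gamma>': "(\<gamma> has_vector_derivative b s (\<gamma> s)) (at s within {0..T})" if s: "s \<in> {0..T}" for s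
  proof -
    have "((\<lambda>r. xbar + integral {0..r} (\<lambda>s. b s (\<gamma> s))) has_vector_derivative b s (\<gamma> s)) (at s within {0..T})"
      using has_vector_derivative_add[OF has_vector_derivative_const integral_has_vector_derivative[OF b_cont s]]
      by simp
    then show ?thesis
    proof (rule has_vector_derivative_transform[OF s, rotated])
      show "\<gamma> r = xbar + integral {0..r} (\<lambda>s. b s (\<gamma> s))" if "r \<in> {0..T}" for r
        using integral_unique[OF \<gamma>(3)[OF that]] by simp
    qed
  qed
  have "?L (\<gamma> t) = 0"
  proof (rule horizontal_curve_zero[of "{1..m}" X T "\<lambda>s. ?L (\<gamma> s)" "\<lambda>i s. a i s (\<gamma> s)" C])
    show "left_invariant_field \<iota> br (X i) \<and> X i 0 \<in> H 1" if "i \<in> {1..m}" for i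
      using X[OF that] basis(3) span_base[of "e i" "e ` {1..m}"] that by auto
    show "((\<lambda>s. ?L (\<gamma> s)) has_vector_derivative (\<Sum>i=1..m. a i s (\<gamma> s) *\<^sub>R X i (?L (\<gamma> s))))
        (at s within {0..T})" if s: "s \<in> {0..T}" for s
    proof -
      have "((\<lambda>s. ?L (\<gamma> s)) has_derivative (\<lambda>r. ?DL (\<gamma> s) (r *\<^sub>R b s (\<gamma> s)))) (at s within {0..T})"
        using has_derivative_compose[OF \<gamma>'[OF s, unfolded has_vector_derivative_def] DL] .
      moreover have "?DL (\<gamma> s) (b s (\<gamma> s)) = (\<Sum>i=1..m. a i s (\<gamma> s) *\<^sub>R X i (?L (\<gamma> s)))"
        using b[OF s \<gamma>(2)[OF s]] DL_X by simp
      ultimately show ?thesis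
        by (simp add: has_vector_derivative_def linear_cmul[OF lin_DL])
    qed
    \<comment> \<open>The Lipschitz bound against \<open>xbar\<close>, where the coefficient
      vanishes; the distance to \<open>xbar\<close> equals that of the translated point to
      0.\<close>
    show "\<bar>a i s (\<gamma> s)\<bar> \<le> C * d (?L (\<gamma> s)) 0" if "i \<in> {1..m}" "s \<in> {0..T}" for i s
      using C(2)[OF that \<gamma>(2)[OF that(2)] assms(8)] a_xbar[OF that(2,1)] by (simp add: L_d)
  qed (use C t sol bch_minus_left in auto)
  then show "\<gamma> t = xbar"
    using L_d[of t] by simp
qed

end
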